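(* For every integer $n\ge 1$, the generalized FiboCatalan number for $r=1$, $$\frac{2\,F_{2n}!}{F_{n+2}!\,F_n!}=\frac{1}{F_{n+2}}\,2\,C_{n,F},$$ is a positive integer (the displayed equality being part of the statement).
   Context: $F_n$ denotes the Fibonacci numbers: $F_0=0$, $F_1=1$, $F_n=F_{n-1}+F_{n-2}$ for $n\ge 2$. The notation $F_n!$ means the product $F_nF_{n-1}\cdots F_2F_1$ for $n\ge 1$ (not the factorial of the integer $F_n$). The fibonomial coefficients are $\binom{n}{k}_F=\frac{F_n!}{F_k!\,F_{n-k}!}$, and the FiboCatalan numbers are $C_{n,F}=\frac{1}{F_{n+1}}\binom{2n}{n}_F$. The generalized FiboCatalan number with parameter $r$ is $\frac{F_{2r+1}!}{F_r!}\cdot\frac{F_{2n}!}{F_n!\,F_{n+r+1}!}$; for $r=1$ the prefactor equals $2$. *)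

theory Defs
  imports Complex_Main "HOL-Number_Theory.Fib"
begin

text \<open>The product \<open>F\<^sub>n F\<^sub>n\<^sub>-\<^sub>1 \<dots> F\<^sub>1\<close>, not the factorial of \<open>F\<^sub>n\<close>; for \<open>n = 0\<close> it is the
  empty product 1.\<close>

definition fib_fact :: "nat \<Rightarrow> nat" where
  "fib_fact n = (\<Prod>i = 1..n. fib i)"

text \<open>The quotients below are taken in the field of rationals, so that integrality is not
  built into the definitions. The fibonomial coefficient is meaningful only for \<open>k \<le> n\<close>, as
  subtraction of naturals truncates.\<close>

definition fibonomial :: "nat \<Rightarrow> nat \<Rightarrow> rat" where
  "fibonomial n k = of_nat (fib_fact n) / (of_nat (fib_fact k) * of_nat (fib_fact (n - k)))"

definition fibocatalan :: "nat \<Rightarrow> rat" where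
  "fibocatalan n = 1 / of_nat (fib (n + 1)) * fibonomial (2 * n) n"

definition gen_fibocatalan :: "nat \<Rightarrow> nat \<Rightarrow> rat" where
  "gen_fibocatalan r n =
     of_nat (fib_fact (2 * r + 1)) / of_nat (fib_fact r) *
     (of_nat (fib_fact (2 * n)) / (of_nat (fib_fact n) * of_nat (fib_fact (n + r + 1))))"

end

(* Write B for the central fibonomial coefficient. Integrality of the fibonomials next to B says
   that F_(n+1) divides B F_n and that F_(n+2) divides B F_n F_(n-1). Since gcd(F_i, F_j) is
   F_gcd(i,j), the first gives F_(n+1) | B, and the second gives F_(n+2) | 2 B because
   gcd(F_(n+2), F_n) = 1 and gcd(F_(n+2), F_(n-1)) divides F_3 = 2. As F_(n+1) and F_(n+2) are
   coprime, their product divides 2 B. *)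

theory Submission
  imports Defs "HOL-Computational_Algebra.Primes"
begin

lemma fib_fact_0 [simp]: "fib_fact 0 = 1"
  by (simp add: fib_fact_def)

lemma fib_fact_Suc [simp]: "fib_fact (Suc n) = fib_fact n * fib (Suc n)"
  by (simp add: fib_fact_def)

lemma fib_fact_pos [simp]: "fib_fact n > 0"
  by (induction n) (simp_all add: fib_neq_0_nat)

text \<open>Integrality of the fibonomials in division-free form. It follows by induction on
  \<open>k + m\<close> from a Pascal-type recurrence that comes from the addition formula for
  Fibonacci numbers.\<close>

lemma fib_fact_mult_dvd: "fib_fact k * fib_fact m dvd fib_fact (k + m)"
proof (induction "k + m" arbitrary: k m)
  case (Suc s)
  show ?case
  proof (cases "k = 0 \<or> m = 0")
    case False
    then obtain k' m' where km: "k = Suc k'" "m = Suc m'"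
      by (metis not0_implies_Suc)
    have "fib_fact k * fib_fact m' dvd fib_fact (k + m')"
      using Suc(1)[of k m'] Suc(2) km by (simp del: fib_fact_Suc)
    then have left: "fib_fact k * fib_fact m dvd fib_fact (k + m') * (fib (Suc k) * fib m)"
      unfolding km(2) by (metis dvd_triv_right fib_fact_Suc mult.assoc mult_dvd_mono)
    have "fib_fact k' * fib_fact m dvd fib_fact (k + m')"
      using Suc(1)[of k' m] Suc(2) km by (simp del: fib_fact_Suc)
    then have "fib_fact k' * fib_fact m * fib k dvd fib_fact (k + m') * (fib k * fib m')"
      by (intro mult_dvd_mono) simp_all
    then have right: "fib_fact k * fib_fact m dvd fib_fact (k + m') * (fib k * fib m')"
      by (simp add: km(1) mult_ac)
    \<comment> \<open>The addition formula splits the top factor \<open>fib (k + m)\<close>, where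
      \<open>k + m = Suc (m' + k)\<close>; \<open>left\<close> and \<open>right\<close> handle one
      summand each.\<close>
    have "fib_fact (k + m) = fib_fact (k + m') * (fib (Suc k) * fib m + fib k * fib m')"
      using fib_add[of m' k] by (simp add: km(2) add.commute mult.commute)
    then show ?thesis
      using dvd_add[OF left right] by (simp add: distrib_left)
  qed auto
qed simp

text \<open>The gcd of the two values is \<open>fib (gcd m n)\<close>, and
  \<open>fib 1 = fib 2 = 1\<close>.\<close>

lemma coprime_fib: "coprime (fib m) (fib n)" if "gcd m n \<in> {1, 2}"
proof -
  have "gcd (fib m) (fib n) = 1"
    using that fib_gcd[of m n, symmetric] by (metis fib_1 fib_2 insertE singletonD)
  then show ?thesis
    by (rule coprime_iff_gcd_eq_1[THEN iffD2])
qed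

lemma gcd_fib_add_3_dvd_2: "gcd (fib (n + 3)) (fib n) dvd 2"
proof -
  have "gcd (n + 3) n dvd 3"
    using dvd_diff_nat[of "gcd (n + 3) n" "n + 3" n] by simp
  then have "gcd (n + 3) n \<in> {1, 3}"
    using prime_nat_iff[of 3] by simp
  then have "fib (gcd (n + 3) n) dvd 2"
  proof (elim insertE)
    assume "gcd (n + 3) n = 3"
    then show ?thesis by (simp only:) (simp add: numeral_eq_Suc)
  qed (simp_all only: fib_1 one_dvd empty_iff)
  then show ?thesis
    by (simp only: fib_gcd)
qed

lemma fib_fact_dvd_two_mult: "fib_fact (n + 2) * fib_fact n dvd 2 * fib_fact (2 * n)"
\<comment> \<open>The small cases are checked directly, since the argument below needs the index
  \<open>m = n - 2\<close>.\<close>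
proof (cases "n \<le> 1")
  case True
  then have "n = 0 \<or> n = 1" by auto
  then show ?thesis by (auto simp: numeral_2_eq_2)
next
  case False
  then obtain m where n: "n = Suc (Suc m)"
    by (metis One_nat_def le_SucI le_refl less_eq_nat.simps(1) not0_implies_Suc)
  obtain B where B: "fib_fact (2 * n) = B * (fib_fact n * fib_fact n)"
    using fib_fact_mult_dvd[of n n] unfolding mult_2 by (metis dvdE mult.commute)
  \<comment> \<open>\<open>P\<close> is the factor shared by both neighbouring divisibilities and is
    cancelled from each. In terms of it,
    \<open>fib_fact (2 * n) = P * B * fib (Suc m) * fib n\<close>, with
    \<open>Suc m = n - 1\<close>.\<close>
  define P where "P = fib_fact n * fib_fact m"
  have P: "P > 0" by (simp add: P_def)
  have "fib_fact (n + 1) * fib_fact (Suc m) dvd fib_fact (2 * n)"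
    using fib_fact_mult_dvd[of "n + 1" "Suc m"] by (simp add: n mult_2 del: fib_fact_Suc)
  then have "(P * fib (Suc m)) * fib (n + 1) dvd (P * fib (Suc m)) * (B * fib n)"
    unfolding B P_def by (simp add: n mult_ac del: fib.simps)
  then have "fib (n + 1) dvd B * fib n"
    using P fib_neq_0_nat[of "Suc m"] by (simp del: fib.simps)
  moreover have "coprime (fib (n + 1)) (fib n)"
    by (intro coprime_fib) simp
  ultimately have 1: "fib (n + 1) dvd B"
    by (simp add: coprime_dvd_mult_left_iff)
  have "fib_fact (n + 2) * fib_fact m dvd fib_fact (2 * n)"
    using fib_fact_mult_dvd[of "n + 2" m] by (simp add: n mult_2 del: fib_fact_Suc)
  then have "P * (fib (n + 1) * fib (n + 2)) dvd P * (B * fib (Suc m) * fib n)"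
    unfolding B P_def by (simp add: n mult_ac del: fib.simps)
  then have "fib (n + 2) dvd B * fib (Suc m) * fib n"
    using P dvd_mult_right by (metis nat_mult_dvd_cancel1)
  moreover have "gcd (n + 2) n dvd 2"
    using dvd_diff_nat[of "gcd (n + 2) n" "n + 2" n] by simp
  then have "coprime (fib (n + 2)) (fib n)"
    by (intro coprime_fib)
      (use dvd_imp_le[of "gcd (n + 2) n" 2] in \<open>auto simp: le_Suc_eq numeral_2_eq_2\<close>)
  ultimately have "fib (n + 2) dvd B * fib (Suc m)"
    by (simp add: coprime_dvd_mult_left_iff)
  \<comment> \<open>\<open>fib (n + 2)\<close> divides both \<open>B * fib (n + 2)\<close> and
    \<open>B * fib (Suc m)\<close>, hence their gcd. The indices \<open>n + 2\<close> and
    \<open>Suc m\<close> differ by 3, which is where the factor 2 enters.\<close>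
  then have "fib (n + 2) dvd B * gcd (fib (n + 2)) (fib (Suc m))"
    unfolding gcd_mult_distrib_nat by (intro gcd_greatest) simp_all
  moreover have "gcd (fib (n + 2)) (fib (Suc m)) dvd 2"
    using gcd_fib_add_3_dvd_2[of "Suc m"] by (simp add: n numeral_3_eq_3 del: fib.simps)
  ultimately have 2: "fib (n + 2) dvd 2 * B"
    by (metis dvd_trans mult.commute mult_dvd_mono dvd_refl)
  have "coprime (fib (n + 1)) (fib (n + 2))"
    using coprime_fib_Suc_nat[of "n + 1"] by (simp del: fib.simps)
  then have "fib (n + 1) * fib (n + 2) dvd 2 * B"
    using 1 2 by (intro divides_mult) auto
  then have "(fib_fact n * fib_fact n) * (fib (n + 1) * fib (n + 2)) dvd
      (fib_fact n * fib_fact n) * (2 * B)"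
    by (rule mult_dvd_mono[OF dvd_refl])
  then show ?thesis
    unfolding B by (simp add: mult_ac del: fib.simps)
qed

theorem corollary3:
  fixes n :: nat
  assumes "n \<ge> 1"
  shows "gen_fibocatalan 1 n =
           2 * of_nat (fib_fact (2 * n)) / (of_nat (fib_fact (n + 2)) * of_nat (fib_fact n))
       \<and> (2 * of_nat (fib_fact (2 * n)) / (of_nat (fib_fact (n + 2)) * of_nat (fib_fact n)) :: rat) =
           1 / of_nat (fib (n + 2)) * 2 * fibocatalan n
       \<and> gen_fibocatalan 1 n \<in> \<int>
       \<and> gen_fibocatalan 1 n > 0"
proof -
  let ?q = "2 * of_nat (fib_fact (2 * n)) / (of_nat (fib_fact (n + 2)) * of_nat (fib_fact n)) :: rat"
  \<comment> \<open>The prefactor is \<open>fib_fact 3 / fib_fact 1 = 2\<close>.\<close>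
  have eq: "gen_fibocatalan 1 n = ?q"
    by (simp add: gen_fibocatalan_def numeral_3_eq_3 mult.commute del: fib_fact_Suc)
      (simp add: numeral_2_eq_2)
  have "?q = 1 / of_nat (fib (n + 2)) * 2 * fibocatalan n"
    by (simp add: fibocatalan_def fibonomial_def mult_ac del: fib.simps)
  moreover have "?q \<in> \<int>"
  proof -
    \<comment> \<open>The cofactor \<open>c\<close> of the divisibility over the naturals is the
      value of the rational quotient.\<close>
    obtain c where c: "2 * fib_fact (2 * n) = fib_fact (n + 2) * fib_fact n * c"
      using fib_fact_dvd_two_mult[of n] by (elim dvdE)
    have "?q = of_nat (2 * fib_fact (2 * n)) / of_nat (fib_fact (n + 2) * fib_fact n)"
      by simp
    also have "\<dots> = of_nat c"
      unfolding c of_nat_mult[of _ c]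
      using fib_fact_pos[of "n + 2"] fib_fact_pos[of n]
      by (metis nonzero_mult_div_cancel_left mult_eq_0_iff of_nat_eq_0_iff less_irrefl)
    finally show "?q \<in> \<int>"
      by (simp only: Ints_of_nat)
  qed
  moreover have "?q > 0"
    by (intro divide_pos_pos mult_pos_pos) (simp_all del: fib_fact_Suc add_2_eq_Suc')
  ultimately show ?thesis
    unfolding eq by blast
qed

end
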